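(* Let $T:E\to F$ be a positive $DW$-limited operator between Banach lattices $E$ and $F$. Let $W\subset E$ be a disjointly weakly compact set and let $V\subset F'$ be a disjointly weak$^*$-compact set. Then the following statements hold: (1) For every disjoint sequence $(x_n)$ in the solid hull $Sol(W)$ of $W$, the sequence $(Tx_n)$ converges uniformly to zero on the solid hull $Sol(V)$ of $V$, i.e. $\sup_{f\in Sol(V)}|f(Tx_n)|\to 0$ as $n\to\infty$. (2) For each $\epsilon>0$ there exists some $u\in E^+$ satisfying $\langle |f|, T[(|x|-u)^+]\rangle<\epsilon$ for all $x\in W$ and all $f\in V$.
   Context: All Banach spaces and Banach lattices are real; $X'$ is the topological dual of $X$, and $F'$ is regarded as a Banach lattice with its dual order. $E^+$ is the positive cone of $E$. For a subset $A$ of a Banach lattice $E$, $Sol(A)=\{y\in E: |y|\le |x| \text{ for some } x\in A\}$. A sequence $(x_n)$ is disjoint if $|x_n|\wedge|x_m|=0$ for $n\ne m$. A bounded subset $A$ of a Banach lattice $E$ is disjointly weakly compact if every disjoint sequence in $Sol(A)$ converges weakly to zero. A bounded subset $A$ of the dual $E'$ of a Banach lattice $E$ is disjointly weak$^*$-compact if every disjoint sequence in $Sol(A)\subset E'$ converges to zero in the weak$^*$ topology. A bounded subset $A$ of a Banach space $X$ is a limited set if $\sup_{x\in A}|f_n(x)|\to 0$ for every weak$^*$-null sequence $(f_n)$ in $X'$. A bounded linear operator $T:E\to X$ from a Banach lattice to a Banach space is $DW$-limited if $T(A)$ is a limited set for each disjointly weakly compact subset $A$ of $E$. *)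

theory Defs
  imports "HOL-Analysis.Analysis" "HOL-Library.Lattice_Algebras"
begin

section \<open>Banach lattices\<close>

class banach_lattice = banach + ordered_real_vector + lattice_ab_group_add_abs +
  assumes norm_abs_mono: "\<bar>x\<bar> \<le> \<bar>y\<bar> \<Longrightarrow> norm x \<le> norm y"

instance real :: banach_lattice
  by standard simp

lemma norm_abs_eq [simp]: "norm \<bar>x\<bar> = norm (x::'a::banach_lattice)"
  by (intro antisym norm_abs_mono) auto

lemma norm_mono_nonneg: "0 \<le> x \<Longrightarrow> x \<le> y \<Longrightarrow> norm x \<le> norm (y::'a::banach_lattice)"
  by (intro norm_abs_mono) auto


section \<open>The dual Banach lattice\<close>

text \<open>
  A type class instance may constrain the argument types of a type constructor only by
  classes. The following class, whose only member up to isomorphism is \<^typ>\<open>real\<close>, makes it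
  possible to equip the dual space \<open>'a \<Rightarrow>\<^sub>L real\<close>, but not spaces of operators in general, with
  its dual order and to make it an instance of \<^class>\<open>banach_lattice\<close>.
\<close>

class real_line = banach_lattice + real_normed_field + conditionally_complete_linorder

instance real :: real_line ..

lemma le_norm_scaleR:
  fixes y :: "'a::real_line"
  shows "y \<le> norm y *\<^sub>R \<bar>1\<bar>"
proof (rule ccontr)
  assume "\<not> ?thesis"
  then have pos: "0 < y - norm y *\<^sub>R \<bar>1\<bar>" (is "0 < ?z")
    by simp
  have small: "norm ?z \<le> e" if "e > 0" for e
  proof -
    have "y \<le> (norm y + e) *\<^sub>R \<bar>1\<bar>"
    proof (rule ccontr)
      assume "\<not> ?thesis"
      then have "(norm y + e) *\<^sub>R \<bar>1\<bar> \<le> y" by simp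
      then have "norm ((norm y + e) *\<^sub>R \<bar>1::'a\<bar>) \<le> norm y"
        using that by (intro norm_mono_nonneg scaleR_nonneg_nonneg) auto
      then show False using that by simp
    qed
    then have "?z \<le> e *\<^sub>R \<bar>1\<bar>" by (simp add: algebra_simps)
    then have "norm ?z \<le> norm (e *\<^sub>R \<bar>1::'a\<bar>)"
      using pos by (intro norm_mono_nonneg) auto
    then show ?thesis using that by simp
  qed
  have "norm ?z \<le> 0" by (rule field_le_epsilon) (simp only: add_0_left small)
  then show False using pos by simp
qed

lemma le_scaleR_1:
  fixes y :: "'a::real_line"
  assumes "norm y \<le> c"
  shows "y \<le> c *\<^sub>R \<bar>1\<bar>"
  by (rule order_trans[OF le_norm_scaleR scaleR_right_mono[OF assms abs_ge_zero]])

lemma riesz_decomposition: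
  fixes a b y :: "'a::banach_lattice"
  assumes "0 \<le> a" "0 \<le> b" "0 \<le> y" "y \<le> a + b"
  obtains u v where "y = u + v" "0 \<le> u" "u \<le> a" "0 \<le> v" "v \<le> b"
proof
  show "y = inf y a + (y - inf y a)" by (simp del: diff_inf_eq_sup)
  show "0 \<le> inf y a" "inf y a \<le> a" using assms by auto
  show "0 \<le> y - inf y a" using inf_le1[of y a] by (simp only: diff_ge_0_iff_ge)
  have "y - b \<le> inf y a" using assms by (auto simp: algebra_simps)
  then show "y - inf y a \<le> b" by (simp only: diff_le_eq add.commute)
qed

lemma pprt_minus_pprt: "pprt x - pprt (- x) = (x::'a::banach_lattice)"
  using prts[of x] by (simp add: pprt_neg)

lemma norm_pprt_le: "norm (pprt x) \<le> norm (x::'a::banach_lattice)"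
proof -
  have "pprt x \<le> \<bar>x\<bar>" unfolding pprt_def by (intro le_supI abs_ge_self abs_ge_zero)
  then have "norm (pprt x) \<le> norm \<bar>x\<bar>" by (intro norm_mono_nonneg) auto
  then show ?thesis by simp
qed

lemma riesz_kantorovich:
  fixes h :: "'a::banach_lattice \<Rightarrow>\<^sub>L 'b::real_line"
  obtains p :: "'a \<Rightarrow>\<^sub>L 'b"
  where "\<And>x. 0 \<le> x \<Longrightarrow> blinfun_apply p x = (SUP y\<in>{0..x}. blinfun_apply h y)"
    and "\<And>x y. 0 \<le> y \<Longrightarrow> y \<le> x \<Longrightarrow> blinfun_apply h y \<le> blinfun_apply p x"
    and "\<And>x c. 0 \<le> x \<Longrightarrow> (\<And>y. 0 \<le> y \<Longrightarrow> y \<le> x \<Longrightarrow> blinfun_apply h y \<le> c) \<Longrightarrow>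
      blinfun_apply p x \<le> c"
proof -
  define P where "P x = (SUP y\<in>{0..x}. blinfun_apply h y)" for x
  have le: "blinfun_apply h y \<le> (norm h * norm x) *\<^sub>R \<bar>1\<bar>" if "0 \<le> y" "y \<le> x" for x y
    using that by (intro le_scaleR_1 order_trans[OF norm_blinfun] mult_left_mono norm_mono_nonneg) auto
  have bdd: "bdd_above (blinfun_apply h ` {0..x})" for x
    using le[of _ x] by (intro bdd_aboveI2) auto
  have up: "blinfun_apply h y \<le> P x" if "0 \<le> y" "y \<le> x" for x y
    unfolding P_def using that bdd by (intro cSUP_upper) auto
  have least: "P x \<le> c" if "0 \<le> x" "\<And>y. 0 \<le> y \<Longrightarrow> y \<le> x \<Longrightarrow> blinfun_apply h y \<le> c" for x c
    unfolding P_def using that by (intro cSUP_least) auto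
  have P_nonneg: "0 \<le> P x" if "0 \<le> x" for x
    using up[of 0 x] that by (simp add: blinfun.zero_right)
  have P_norm: "norm (P x) \<le> norm h * norm x" if "0 \<le> x" for x
  proof -
    have "P x \<le> (norm h * norm x) *\<^sub>R \<bar>1\<bar>"
      using that le by (intro least)
    then have "norm (P x) \<le> norm ((norm h * norm x) *\<^sub>R \<bar>1::'b\<bar>)"
      using P_nonneg[OF that] by (intro norm_mono_nonneg)
    then show ?thesis by simp
  qed
  have P_add: "P (a + b) = P a + P b" if ab: "0 \<le> a" "0 \<le> b" for a b
  proof (rule antisym)
    show "P (a + b) \<le> P a + P b"
    proof (rule least)
      fix y assume "0 \<le> y" "y \<le> a + b"
      then obtain u v where "y = u + v" "0 \<le> u" "u \<le> a" "0 \<le> v" "v \<le> b"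
        using riesz_decomposition ab by metis
      then show "blinfun_apply h y \<le> P a + P b"
        using up[of u a] up[of v b] by (simp add: blinfun.add_right add_mono)
    qed (use ab in auto)
    have "P a \<le> P (a + b) - P b"
    proof (rule least)
      fix u assume u: "0 \<le> u" "u \<le> a"
      have "P b \<le> P (a + b) - blinfun_apply h u"
      proof (rule least)
        fix v assume v: "0 \<le> v" "v \<le> b"
        have "blinfun_apply h (u + v) \<le> P (a + b)"
          using u v by (intro up add_mono add_nonneg_nonneg)
        then show "blinfun_apply h v \<le> P (a + b) - blinfun_apply h u"
          by (simp add: blinfun.add_right algebra_simps)
      qed (use ab in auto)
      then show "blinfun_apply h u \<le> P (a + b) - P b" by (simp add: algebra_simps)
    qed (use ab in auto)
    then show "P a + P b \<le> P (a + b)" by (simp add: algebra_simps)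
  qed
  have P_le: "P (r *\<^sub>R x) \<le> r *\<^sub>R P x" if "0 < r" "0 \<le> x" for r x
  proof (rule least)
    fix y assume y: "0 \<le> y" "y \<le> r *\<^sub>R x"
    have "inverse r *\<^sub>R y \<le> inverse r *\<^sub>R (r *\<^sub>R x)"
      using y that by (intro scaleR_left_mono) auto
    then have "blinfun_apply h (inverse r *\<^sub>R y) \<le> P x"
      using y that by (intro up) (auto intro: scaleR_nonneg_nonneg)
    then have "r *\<^sub>R blinfun_apply h (inverse r *\<^sub>R y) \<le> r *\<^sub>R P x"
      using that by (intro scaleR_left_mono) auto
    then show "blinfun_apply h y \<le> r *\<^sub>R P x"
      using that by (simp add: blinfun.scaleR_right)
  qed (use that in \<open>auto intro: scaleR_nonneg_nonneg\<close>)
  have P_zero: "P 0 = 0"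
    using P_add[of 0 0] by simp
  have P_scale: "P (r *\<^sub>R x) = r *\<^sub>R P x" if "0 \<le> r" "0 \<le> x" for r x
  proof (cases "r = 0")
    case False
    then have r: "0 < r" using that by simp
    have "P (inverse r *\<^sub>R (r *\<^sub>R x)) \<le> inverse r *\<^sub>R P (r *\<^sub>R x)"
      using r that by (intro P_le) (auto intro: scaleR_nonneg_nonneg)
    then have "r *\<^sub>R P x \<le> r *\<^sub>R (inverse r *\<^sub>R P (r *\<^sub>R x))"
      using r by (intro scaleR_left_mono) auto
    then show ?thesis using P_le[OF r that(2)] r by (intro antisym) auto
  qed (simp add: P_zero)
  define L where "L x = P (pprt x) - P (pprt (- x))" for x
  have L_diff: "L (a - b) = P a - P b" if "0 \<le> a" "0 \<le> b" for a b
  proof -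
    have "pprt (a - b) + b = a + pprt (- (a - b))"
      using pprt_minus_pprt[of "a - b"] by (simp add: algebra_simps)
    then have "P (pprt (a - b)) + P b = P a + P (pprt (- (a - b)))"
      using that P_add[of "pprt (a - b)" b] P_add[of a "pprt (- (a - b))"] by auto
    then show ?thesis unfolding L_def by (simp add: algebra_simps)
  qed
  have "bounded_linear L"
  proof (rule bounded_linear_intro[where K = "2 * norm h"])
    fix x y
    have "L ((pprt x + pprt y) - (pprt (- x) + pprt (- y))) = L x + L y"
      by (subst L_diff) (auto simp: P_add L_def)
    moreover have "(pprt x + pprt y) - (pprt (- x) + pprt (- y)) = x + y"
      unfolding add_diff_add by (simp only: pprt_minus_pprt)
    ultimately show "L (x + y) = L x + L y" by simp
  next
    fix r x
    show "L (r *\<^sub>R x) = r *\<^sub>R L x"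
    proof (cases "0 \<le> r")
      case True
      have "L (r *\<^sub>R pprt x - r *\<^sub>R pprt (- x)) = r *\<^sub>R (P (pprt x) - P (pprt (- x)))"
        using True
        by (subst L_diff)
          (auto simp: P_scale scaleR_right_diff_distrib intro!: scaleR_nonneg_nonneg)
      then have "L (r *\<^sub>R (pprt x - pprt (- x))) = r *\<^sub>R L x"
        unfolding L_def[of x] scaleR_right_diff_distrib .
      then show ?thesis unfolding pprt_minus_pprt .
    next
      case False
      have "L ((- r) *\<^sub>R pprt (- x) - (- r) *\<^sub>R pprt x) = (- r) *\<^sub>R (P (pprt (- x)) - P (pprt x))"
        using False P_scale[of "- r"]
        by (subst L_diff) (auto simp: scaleR_right_diff_distrib intro!: scaleR_nonneg_nonneg
            simp del: scaleR_minus_left)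
      moreover have "(- r) *\<^sub>R pprt (- x) - (- r) *\<^sub>R pprt x = r *\<^sub>R (pprt x - pprt (- x))"
        by (simp add: scaleR_right_diff_distrib)
      ultimately have "L (r *\<^sub>R x) = (- r) *\<^sub>R (P (pprt (- x)) - P (pprt x))"
        unfolding pprt_minus_pprt by metis
      then show ?thesis by (simp add: L_def scaleR_right_diff_distrib)
    qed
  next
    fix x
    have "norm (L x) \<le> norm (P (pprt x)) + norm (P (pprt (- x)))"
      unfolding L_def by (rule norm_triangle_ineq4)
    also have "\<dots> \<le> norm h * norm (pprt x) + norm h * norm (pprt (- x))"
      by (intro add_mono P_norm) auto
    also have "\<dots> \<le> norm h * norm x + norm h * norm x"
      using norm_pprt_le[of x] norm_pprt_le[of "- x"]
      by (intro add_mono mult_left_mono) auto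
    finally show "norm (L x) \<le> norm x * (2 * norm h)" by (simp add: algebra_simps)
  qed
  then have app: "blinfun_apply (Blinfun L) x = P x" if "0 \<le> x" for x
    using that by (simp add: bounded_linear_Blinfun_apply L_def P_zero)
  show ?thesis
    by (rule that[of "Blinfun L"]) (auto simp: app P_def[symmetric] intro: up least)
qed

instantiation blinfun :: (banach_lattice, real_line) banach_lattice
begin

definition less_eq_blinfun :: "('a \<Rightarrow>\<^sub>L 'b) \<Rightarrow> ('a \<Rightarrow>\<^sub>L 'b) \<Rightarrow> bool" where
  "f \<le> g \<longleftrightarrow> (\<forall>x\<ge>0. blinfun_apply f x \<le> blinfun_apply g x)"

definition less_blinfun :: "('a \<Rightarrow>\<^sub>L 'b) \<Rightarrow> ('a \<Rightarrow>\<^sub>L 'b) \<Rightarrow> bool" where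
  "f < g \<longleftrightarrow> f \<le> g \<and> \<not> g \<le> (f :: 'a \<Rightarrow>\<^sub>L 'b)"

definition sup_blinfun :: "('a \<Rightarrow>\<^sub>L 'b) \<Rightarrow> ('a \<Rightarrow>\<^sub>L 'b) \<Rightarrow> ('a \<Rightarrow>\<^sub>L 'b)" where
  "sup f g = (THE h :: 'a \<Rightarrow>\<^sub>L 'b. f \<le> h \<and> g \<le> h \<and> (\<forall>k. f \<le> k \<and> g \<le> k \<longrightarrow> h \<le> k))"

definition inf_blinfun :: "('a \<Rightarrow>\<^sub>L 'b) \<Rightarrow> ('a \<Rightarrow>\<^sub>L 'b) \<Rightarrow> ('a \<Rightarrow>\<^sub>L 'b)" where
  "inf f g = - sup (- f) (- g :: 'a \<Rightarrow>\<^sub>L 'b)"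

definition abs_blinfun :: "('a \<Rightarrow>\<^sub>L 'b) \<Rightarrow> ('a \<Rightarrow>\<^sub>L 'b)" where
  "\<bar>f\<bar> = sup f (- f :: 'a \<Rightarrow>\<^sub>L 'b)"

instance
proof
  fix f g h :: "'a \<Rightarrow>\<^sub>L 'b" and r s :: real
  have antisym: "f = g" if "f \<le> g" "g \<le> f" for f g :: "'a \<Rightarrow>\<^sub>L 'b"
  proof (rule blinfun_eqI)
    fix x :: 'a
    have eq: "blinfun_apply f y = blinfun_apply g y" if "0 \<le> y" for y
      using \<open>f \<le> g\<close> \<open>g \<le> f\<close> that by (auto simp: less_eq_blinfun_def intro: order.antisym)
    have "x = pprt x - pprt (- x)" using prts[of x] by (simp add: pprt_neg)
    moreover have "blinfun_apply f (pprt x - pprt (- x)) = blinfun_apply g (pprt x - pprt (- x))"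
      by (simp add: blinfun.diff_right eq)
    ultimately show "blinfun_apply f x = blinfun_apply g x" by metis
  qed
  have lub: "\<exists>s. f \<le> s \<and> g \<le> s \<and> (\<forall>k. f \<le> k \<and> g \<le> k \<longrightarrow> s \<le> k) \<and>
      (\<forall>x c. 0 \<le> x \<longrightarrow> (\<forall>y. 0 \<le> y \<and> y \<le> x \<longrightarrow> blinfun_apply f x + blinfun_apply (g - f) y \<le> c)
        \<longrightarrow> blinfun_apply s x \<le> c)" for f g :: "'a \<Rightarrow>\<^sub>L 'b"
  proof -
    obtain p :: "'a \<Rightarrow>\<^sub>L 'b" where
      up: "\<And>x y. 0 \<le> y \<Longrightarrow> y \<le> x \<Longrightarrow> blinfun_apply (g - f) y \<le> blinfun_apply p x"
      and least: "\<And>x c. 0 \<le> x \<Longrightarrow>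
        (\<And>y. 0 \<le> y \<Longrightarrow> y \<le> x \<Longrightarrow> blinfun_apply (g - f) y \<le> c) \<Longrightarrow> blinfun_apply p x \<le> c"
      using riesz_kantorovich[of "g - f"] by metis
    show ?thesis
    proof (intro exI[of _ "f + p"] conjI allI impI)
      show "f \<le> f + p"
        unfolding less_eq_blinfun_def
        using up[of 0] by (simp add: blinfun.add_left blinfun.zero_right)
      show "g \<le> f + p"
        unfolding less_eq_blinfun_def
      proof (intro allI impI)
        fix x :: 'a assume "0 \<le> x"
        then have "blinfun_apply (g - f) x \<le> blinfun_apply p x" by (intro up) auto
        then show "blinfun_apply g x \<le> blinfun_apply (f + p) x"
          by (simp add: blinfun.add_left blinfun.diff_left algebra_simps)
      qed
    next
      fix k assume k: "f \<le> k \<and> g \<le> k"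
      show "f + p \<le> k"
        unfolding less_eq_blinfun_def
      proof (intro allI impI)
        fix x :: 'a assume x: "0 \<le> x"
        have "blinfun_apply p x \<le> blinfun_apply (k - f) x"
        proof (rule least[OF x])
          fix y assume y: "0 \<le> y" "y \<le> x"
          have "blinfun_apply (g - f) y \<le> blinfun_apply (k - f) y"
            using k y by (simp add: less_eq_blinfun_def blinfun.diff_left)
          also have "0 \<le> blinfun_apply (k - f) (x - y)"
            using k y by (simp add: less_eq_blinfun_def blinfun.diff_left del: blinfun.diff_right)
          then have "blinfun_apply (k - f) y \<le> blinfun_apply (k - f) x"
            by (simp add: blinfun.diff_right)
          finally show "blinfun_apply (g - f) y \<le> blinfun_apply (k - f) x" .
        qed
        then show "blinfun_apply (f + p) x \<le> blinfun_apply k x"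
          by (simp add: blinfun.add_left blinfun.diff_left algebra_simps)
      qed
    next
      fix x :: 'a and c
      assume x: "0 \<le> x" and
        *: "\<forall>y. 0 \<le> y \<and> y \<le> x \<longrightarrow> blinfun_apply f x + blinfun_apply (g - f) y \<le> c"
      have "blinfun_apply p x \<le> c - blinfun_apply f x"
        using * by (intro least[OF x]) (simp add: algebra_simps)
      then show "blinfun_apply (f + p) x \<le> c" by (simp add: blinfun.add_left algebra_simps)
    qed
  qed
  have sup_eq: "sup f g = s" if "f \<le> s" "g \<le> s" "\<forall>k. f \<le> k \<and> g \<le> k \<longrightarrow> s \<le> k" for f g s :: "'a \<Rightarrow>\<^sub>L 'b"
    unfolding sup_blinfun_def using that by (intro the_equality) (auto intro: antisym)
  have sup: "f \<le> sup f g" "g \<le> sup f g" "f \<le> k \<Longrightarrow> g \<le> k \<Longrightarrow> sup f g \<le> k" for f g k :: "'a \<Rightarrow>\<^sub>L 'b"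
    using lub[of f g] sup_eq[of f _ g] by blast+
  have minus_le: "- f \<le> - g \<longleftrightarrow> g \<le> f" for f g :: "'a \<Rightarrow>\<^sub>L 'b"
    by (simp add: less_eq_blinfun_def blinfun.minus_left)
  show "f < g \<longleftrightarrow> f \<le> g \<and> \<not> g \<le> f" by (rule less_blinfun_def)
  show "f \<le> f" by (simp add: less_eq_blinfun_def)
  show "f \<le> h" if "f \<le> g" "g \<le> h"
    using that by (auto simp: less_eq_blinfun_def intro: order_trans)
  show "f = g" if "f \<le> g" "g \<le> f" using that by (rule antisym)
  show "f \<le> sup f g" "g \<le> sup f g" by (rule sup)+
  show "sup g h \<le> f" if "g \<le> f" "h \<le> f" using that by (rule sup)
  show "inf f g \<le> f" "inf f g \<le> g"
    using sup(1)[of "- f" "- g"] sup(2)[of "- g" "- f"]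
      minus_le[of "sup (- f) (- g)" "- f"] minus_le[of "sup (- f) (- g)" "- g"]
    by (simp_all add: inf_blinfun_def)
  show "f \<le> inf g h" if "f \<le> g" "f \<le> h"
    using sup(3)[of "- g" "- f" "- h"] minus_le[of "- f" "sup (- g) (- h)"] minus_le that
    by (simp add: inf_blinfun_def)
  show "h + f \<le> h + g" if "f \<le> g"
    using that by (simp add: less_eq_blinfun_def blinfun.add_left)
  show "r *\<^sub>R f \<le> r *\<^sub>R g" if "f \<le> g" "0 \<le> r"
    using that by (simp add: less_eq_blinfun_def blinfun.scaleR_left scaleR_left_mono)
  show "r *\<^sub>R f \<le> s *\<^sub>R f" if "r \<le> s" "0 \<le> f"
    using that by (simp add: less_eq_blinfun_def blinfun.scaleR_left scaleR_right_mono)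
  show "\<bar>f\<bar> = sup f (- f)" by (rule abs_blinfun_def)
  show "norm f \<le> norm g" if fg: "\<bar>f\<bar> \<le> \<bar>g\<bar>"
  proof (rule norm_blinfun_bound)
    fix x :: 'a
    have abs_le: "\<bar>blinfun_apply f y\<bar> \<le> blinfun_apply \<bar>f\<bar> y" if "0 \<le> y" for y
      using sup(1)[of f "- f"] sup(2)[of "- f" f] that
      by (intro abs_leI) (auto simp: abs_blinfun_def less_eq_blinfun_def blinfun.minus_left)
    have x: "x = pprt x - pprt (- x)" "\<bar>x\<bar> = pprt x + pprt (- x)"
      using prts[of x] abs_prts[of x] by (simp_all add: pprt_neg)
    have "\<bar>blinfun_apply f (pprt x - pprt (- x))\<bar> \<le> blinfun_apply \<bar>f\<bar> (pprt x + pprt (- x))"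
      using abs_le[of "pprt x"] abs_le[of "pprt (- x)"]
      unfolding blinfun.diff_right blinfun.add_right
      by (intro order_trans[OF abs_triangle_ineq4] add_mono) auto
    then have "\<bar>blinfun_apply f x\<bar> \<le> blinfun_apply \<bar>f\<bar> \<bar>x\<bar>"
      unfolding x[symmetric] .
    also have "\<dots> \<le> blinfun_apply \<bar>g\<bar> \<bar>x\<bar>"
      using fg by (simp add: less_eq_blinfun_def)
    finally have 1: "\<bar>blinfun_apply f x\<bar> \<le> blinfun_apply \<bar>g\<bar> \<bar>x\<bar>" .
    have "blinfun_apply \<bar>g\<bar> \<bar>x\<bar> \<le> (norm g * norm x) *\<^sub>R \<bar>1\<bar>"
    proof -
      obtain s where s: "g \<le> s" "- g \<le> s" "\<forall>k. g \<le> k \<and> - g \<le> k \<longrightarrow> s \<le> k"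
        and least: "\<forall>x c. 0 \<le> x \<longrightarrow> (\<forall>y. 0 \<le> y \<and> y \<le> x \<longrightarrow>
          blinfun_apply g x + blinfun_apply (- g - g) y \<le> c) \<longrightarrow> blinfun_apply s x \<le> c"
        using lub[of g "- g"] by blast
      have "blinfun_apply s \<bar>x\<bar> \<le> (norm g * norm x) *\<^sub>R \<bar>1\<bar>"
      proof (rule least[rule_format])
        fix y assume y: "0 \<le> y \<and> y \<le> \<bar>x\<bar>"
        have eq: "blinfun_apply g \<bar>x\<bar> + blinfun_apply (- g - g) y =
            blinfun_apply g (\<bar>x\<bar> - y - y)"
          by (simp add: blinfun.diff_left blinfun.diff_right blinfun.minus_left)
        have "\<bar>\<bar>x\<bar> - y - y\<bar> \<le> \<bar>x\<bar>"
        proof (rule abs_leI)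
          show "\<bar>x\<bar> - y - y \<le> \<bar>x\<bar>"
            using y add_nonneg_nonneg[of y y] by (simp only: diff_diff_eq diff_le_eq) simp
          show "- (\<bar>x\<bar> - y - y) \<le> \<bar>x\<bar>" using y add_mono[of y "\<bar>x\<bar>" y "\<bar>x\<bar>"]
            by (simp add: algebra_simps)
        qed
        then have "norm (\<bar>x\<bar> - y - y) \<le> norm x" by (rule norm_abs_mono)
        then have "norm (blinfun_apply g (\<bar>x\<bar> - y - y)) \<le> norm g * norm x"
          by (intro order_trans[OF norm_blinfun] mult_left_mono) auto
        then show "blinfun_apply g \<bar>x\<bar> + blinfun_apply (- g - g) y \<le> (norm g * norm x) *\<^sub>R \<bar>1\<bar>"
          unfolding eq by (rule le_scaleR_1)
      qed simp
      moreover have "\<bar>g\<bar> = s" unfolding abs_blinfun_def using s by (rule sup_eq)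
      ultimately show ?thesis by simp
    qed
    with 1 have "\<bar>blinfun_apply f x\<bar> \<le> (norm g * norm x) *\<^sub>R \<bar>1\<bar>" by simp
    then have "norm \<bar>blinfun_apply f x\<bar> \<le> norm ((norm g * norm x) *\<^sub>R \<bar>1::'b\<bar>)"
      by (intro norm_mono_nonneg) auto
    then show "norm (blinfun_apply f x) \<le> norm g * norm x" by simp
  qed simp
qed

end


section \<open>Disjointness and solid hulls\<close>

definition Sol :: "'a::banach_lattice set \<Rightarrow> 'a set" where
  "Sol A = {y. \<exists>x\<in>A. \<bar>y\<bar> \<le> \<bar>x\<bar>}"

definition disjoint_seq :: "(nat \<Rightarrow> 'a::banach_lattice) \<Rightarrow> bool" where
  "disjoint_seq x \<longleftrightarrow> (\<forall>n m. n \<noteq> m \<longrightarrow> inf \<bar>x n\<bar> \<bar>x m\<bar> = 0)"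


section \<open>Weak and weak* null sequences\<close>

definition weakly_null :: "(nat \<Rightarrow> 'a::real_normed_vector) \<Rightarrow> bool" where
  "weakly_null x \<longleftrightarrow> (\<forall>f :: 'a \<Rightarrow>\<^sub>L real. (\<lambda>n. f (x n)) \<longlonglongrightarrow> 0)"

definition weakstar_null :: "(nat \<Rightarrow> ('a::real_normed_vector \<Rightarrow>\<^sub>L real)) \<Rightarrow> bool" where
  "weakstar_null f \<longleftrightarrow> (\<forall>x. (\<lambda>n. f n x) \<longlonglongrightarrow> 0)"


section \<open>Compactness notions and DW-limited operators\<close>

definition disjointly_weakly_compact :: "'a::banach_lattice set \<Rightarrow> bool" where
  "disjointly_weakly_compact A \<longleftrightarrow>
    bounded A \<and> (\<forall>x. disjoint_seq x \<and> range x \<subseteq> Sol A \<longrightarrow> weakly_null x)"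

definition disjointly_weakstar_compact :: "('a::banach_lattice \<Rightarrow>\<^sub>L real) set \<Rightarrow> bool" where
  "disjointly_weakstar_compact A \<longleftrightarrow>
    bounded A \<and> (\<forall>f. disjoint_seq f \<and> range f \<subseteq> Sol A \<longrightarrow> weakstar_null f)"

text \<open>
  Suprema of absolute values are taken in \<^typ>\<open>ennreal\<close>, where the supremum of the empty set
  is \<open>0\<close>; in \<^typ>\<open>real\<close> it would be unspecified.
\<close>

definition limited_set :: "'a::banach set \<Rightarrow> bool" where
  "limited_set A \<longleftrightarrow> bounded A \<and>
    (\<forall>f :: nat \<Rightarrow> 'a \<Rightarrow>\<^sub>L real. weakstar_null f \<longrightarrow>
      (\<lambda>n. SUP x\<in>A. ennreal \<bar>f n x\<bar>) \<longlonglongrightarrow> 0)"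

definition DW_limited :: "('a::banach_lattice \<Rightarrow>\<^sub>L 'b::banach) \<Rightarrow> bool" where
  "DW_limited T \<longleftrightarrow> (\<forall>A. disjointly_weakly_compact A \<longrightarrow> limited_set (T ` A))"

definition positive_operator :: "('a::banach_lattice \<Rightarrow>\<^sub>L 'b::banach_lattice) \<Rightarrow> bool" where
  "positive_operator T \<longleftrightarrow> (\<forall>x\<ge>0. 0 \<le> T x)"

end

theory Submission
  imports Defs
begin

text \<open>
  Suppose that a bounded family of functionals tends to zero, uniformly, along every disjoint
  sequence in the solid hull of a bounded set \<open>A\<close>. Then it is uniformly small on the parts
  \<open>(|x| - u)\<^sup>+\<close>, \<open>x \<in> A\<close>, for a suitable \<open>u\<close>: otherwise one picks successively \<open>x\<^sub>n \<in> A\<close> violating this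
  for \<open>u = 4\<^sup>n (|x\<^sub>0| + \<dots> + |x\<^bsub>n-1\<^esub>|)\<close>, and the violating parts become a disjoint
  sequence after subtracting \<open>2\<^sup>-\<^sup>n \<Sum>\<^sub>k 2\<^sup>-\<^sup>k |x\<^sub>k|\<close> and taking
  positive parts.

  This principle is used twice. A disjoint sequence in \<open>Sol V\<close> is weak* null, hence
  uniformly small on the limited set \<open>T (Sol W)\<close>; the principle in \<open>F'\<close> therefore yields
  \<open>g \<ge> 0\<close> such that \<open>(|f| - g)\<^sup>+ (T |x|)\<close> is uniformly small. Since \<open>g \<circ> T\<close> tends to zero along disjoint
  sequences of \<open>Sol W\<close>, (1) follows. Then the principle in \<open>E\<close>, together with (1), gives (2).
\<close>

section \<open>Disjoint sequences in Banach lattices\<close>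

lemma limit_nonneg:
  fixes x :: "nat \<Rightarrow> 'a::banach_lattice"
  assumes lim: "x \<longlonglongrightarrow> l" and nonneg: "eventually (\<lambda>n. 0 \<le> x n) sequentially"
  shows "0 \<le> l"
proof -
  \<comment> \<open>The negative part of the limit is dominated by \<open>|x n - l|\<close> as soon
    as \<open>x n\<close> is nonnegative, so its norm must vanish.\<close>
  have bound: "norm (pprt (- l)) \<le> norm (x n - l)" if "0 \<le> x n" for n
  proof -
    have "- l \<le> x n - l" using that by simp
    also have "\<dots> \<le> \<bar>x n - l\<bar>" by (rule abs_ge_self)
    finally have "pprt (- l) \<le> \<bar>x n - l\<bar>"
      unfolding pprt_def by (intro le_supI) auto
    then have "norm (pprt (- l)) \<le> norm \<bar>x n - l\<bar>"
      by (intro norm_mono_nonneg) auto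
    then show ?thesis by simp
  qed
  have "(\<lambda>n. norm (x n - l)) \<longlonglongrightarrow> 0"
    using lim by (simp add: LIM_zero tendsto_norm_zero)
  then have "norm (pprt (- l)) \<le> 0"
    by (rule tendsto_lowerbound) (use nonneg bound in \<open>auto elim: eventually_mono\<close>)
  then have "sup (- l) 0 = 0" by (simp add: pprt_def)
  then have "- l \<le> 0" by (metis sup_ge1)
  then show ?thesis by simp
qed

lemma le_sum:
  fixes x :: "'i \<Rightarrow> 'a::banach_lattice"
  assumes "finite I" "i \<in> I" "\<And>k. 0 \<le> x k"
  shows "x i \<le> (\<Sum>k\<in>I. x k)"
  using assms by (simp add: sum.remove[of I i] sum_nonneg)

lemma le_suminf:
  fixes x :: "nat \<Rightarrow> 'a::banach_lattice"
  assumes "summable x" and nonneg: "\<And>n. 0 \<le> x n"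
  shows "x m \<le> suminf x"
proof -
  have "(\<lambda>n. (\<Sum>k<n. x k) - x m) \<longlonglongrightarrow> suminf x - x m"
    using assms(1) by (intro tendsto_diff summable_LIMSEQ tendsto_const)
  moreover have "eventually (\<lambda>n. 0 \<le> (\<Sum>k<n. x k) - x m) sequentially"
    using eventually_gt_at_top[of m]
    by eventually_elim (simp add: le_sum nonneg)
  ultimately have "0 \<le> suminf x - x m" by (rule limit_nonneg)
  then show ?thesis by simp
qed

section \<open>Disjointness of positive parts\<close>

lemma inf_pprt_pprt_minus: "inf (pprt x) (pprt (- x)) = (0::'a::banach_lattice)"
proof -
  \<comment> \<open>Factoring out the translation by \<open>pprt (- x)\<close> leaves
    \<open>inf x 0\<close>, which is \<open>nprt x = - pprt (- x)\<close>.\<close>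
  have "inf (pprt x) (pprt (- x)) = inf (pprt (- x) + x) (pprt (- x) + 0)"
    using pprt_minus_pprt[of x] by (simp add: algebra_simps)
  also have "\<dots> = pprt (- x) + nprt x" unfolding nprt_def by (rule add_inf_distrib_left[symmetric])
  finally show ?thesis by (simp add: pprt_neg)
qed

lemma pprt_scaleR_le:
  fixes x :: "'a::banach_lattice"
  assumes "0 \<le> r"
  shows "pprt (r *\<^sub>R x) \<le> r *\<^sub>R pprt x"
  unfolding pprt_def using assms by (intro le_supI scaleR_left_mono scaleR_nonneg_nonneg) auto

text \<open>Division by \<open>r\<close> puts the infimum below both \<open>pprt c\<close> and
  \<open>pprt (- c)\<close>, which are disjoint; \<open>1 \<le> r\<close> ensures that the division
  preserves the second bound.\<close>

lemma inf_eq_0_if_le_scaleR_pprt: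
  fixes a b c :: "'a::banach_lattice"
  assumes "0 \<le> a" "0 \<le> b" "1 \<le> r" "a \<le> r *\<^sub>R pprt c" "b \<le> pprt (- c)"
  shows "inf a b = 0"
proof (rule antisym)
  have "inverse r *\<^sub>R inf a b \<le> inverse r *\<^sub>R (r *\<^sub>R pprt c)"
    using assms by (intro scaleR_left_mono) (auto intro: le_infI1)
  then have 1: "inverse r *\<^sub>R inf a b \<le> pprt c" using assms by simp
  have "inverse r *\<^sub>R inf a b \<le> 1 *\<^sub>R inf a b"
    using assms by (intro scaleR_right_mono) (auto simp: field_simps)
  also have "\<dots> \<le> pprt (- c)" using assms by (auto intro: le_infI2)
  finally have "inverse r *\<^sub>R inf a b \<le> inf (pprt c) (pprt (- c))" using 1 by simp
  then have "inverse r *\<^sub>R inf a b \<le> 0" by (simp only: inf_pprt_pprt_minus)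
  then have "r *\<^sub>R (inverse r *\<^sub>R inf a b) \<le> r *\<^sub>R 0"
    using assms by (intro scaleR_left_mono) auto
  then show "inf a b \<le> 0" using assms by simp
qed (use assms in simp)

text \<open>For n < m both terms are compared with \<open>c = (1/4)^m x m - x n\<close>: since
  \<open>x n \<le> s m\<close>, the m-th term lies below \<open>4^m pprt c\<close>; since
  \<open>(1/2)^m x m \<le> y\<close>, the n-th term lies below \<open>pprt (- c)\<close>.\<close>

lemma disjoint_seq_pprt:
  fixes x s :: "nat \<Rightarrow> 'a::banach_lattice"
  assumes s: "\<And>n m. n < m \<Longrightarrow> x n \<le> s m" and s_nonneg: "\<And>n. 0 \<le> s n"
    and y: "\<And>n. (1/2)^n *\<^sub>R x n \<le> y" and y_nonneg: "0 \<le> y" and x: "\<And>n. 0 \<le> x n"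
  shows "disjoint_seq (\<lambda>n. pprt (x n - 4^n *\<^sub>R s n - (1/2)^n *\<^sub>R y))" (is "disjoint_seq ?w")
proof -
  have disj: "inf (?w m) (?w n) = 0" if "n < m" for n m
  proof (rule inf_eq_0_if_le_scaleR_pprt[where r = "4^m" and c = "(1/4)^m *\<^sub>R x m - x n"])
    have "4^m *\<^sub>R x n \<le> 4^m *\<^sub>R s m" using s that by (intro scaleR_left_mono) auto
    moreover have "0 \<le> (1/2)^m *\<^sub>R y" using y_nonneg by (intro scaleR_nonneg_nonneg) auto
    ultimately have "4^m *\<^sub>R x n \<le> 4^m *\<^sub>R s m + (1/2)^m *\<^sub>R y"
      using add_mono by fastforce
    then have "x m - 4^m *\<^sub>R s m - (1/2)^m *\<^sub>R y \<le> x m - 4^m *\<^sub>R x n"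
      by (simp add: diff_diff_eq diff_left_mono)
    also have "\<dots> = 4^m *\<^sub>R ((1/4)^m *\<^sub>R x m - x n)"
      by (simp add: scaleR_right_diff_distrib power_mult_distrib[symmetric])
    finally have "?w m \<le> pprt (4^m *\<^sub>R ((1/4)^m *\<^sub>R x m - x n))" by (rule pprt_mono)
    also have "\<dots> \<le> 4^m *\<^sub>R pprt ((1/4)^m *\<^sub>R x m - x n)" by (intro pprt_scaleR_le) simp
    finally show "?w m \<le> \<dots>" .
  next
    \<comment> \<open>One factor \<open>(1/2)^m\<close> brings \<open>x m\<close> below
      \<open>y\<close>; the other is at most the weight \<open>(1/2)^n\<close> of \<open>y\<close>
      in the n-th term.\<close>
    have "(1/4)^m = (1/2::real)^m * (1/2)^m" by (simp add: power_mult_distrib[symmetric])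
    also have "\<dots> \<le> (1/2)^n * (1/2)^m"
      using that by (intro mult_right_mono power_decreasing) auto
    finally have "(1/4)^m *\<^sub>R x m \<le> ((1/2)^n * (1/2)^m) *\<^sub>R x m"
      using x by (intro scaleR_right_mono) auto
    also have "\<dots> \<le> (1/2)^n *\<^sub>R y"
      using y[of m] scaleR_left_mono[of "(1/2)^m *\<^sub>R x m" y "(1/2)^n"] by simp
    finally have "(1/4)^m *\<^sub>R x m \<le> (1/2)^n *\<^sub>R y" .
    moreover have "0 \<le> 4^n *\<^sub>R s n" using s_nonneg by (intro scaleR_nonneg_nonneg) auto
    ultimately have "(1/4)^m *\<^sub>R x m \<le> 4^n *\<^sub>R s n + (1/2)^n *\<^sub>R y"
      using add_mono by fastforce
    then have "x n - 4^n *\<^sub>R s n - (1/2)^n *\<^sub>R y \<le> x n - (1/4)^m *\<^sub>R x m"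
      by (simp only: diff_diff_eq diff_left_mono)
    then show "?w n \<le> pprt (- ((1/4)^m *\<^sub>R x m - x n))"
      by (intro pprt_mono) simp
  qed auto
  show ?thesis
    unfolding disjoint_seq_def
  proof (intro allI impI)
    fix n m :: nat assume "n \<noteq> m"
    then consider "n < m" | "m < n" by linarith
    then have "inf (?w n) (?w m) = 0" by cases (use disj inf.commute in metis)+
    then show "inf \<bar>?w n\<bar> \<bar>?w m\<bar> = 0" by simp
  qed
qed

section \<open>Truncation by an order interval\<close>

lemma le_add_pprt_diff: "a \<le> b + pprt (a - (b::'a::banach_lattice))"
proof -
  have "a - b \<le> pprt (a - b)" unfolding pprt_def by (rule sup_ge1)
  then show ?thesis by (simp only: diff_le_eq add.commute)
qed

lemma pprt_diff_le:
  fixes a b :: "'a::banach_lattice"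
  assumes "0 \<le> b"
  shows "pprt (a - b) \<le> pprt a" and "pprt a - pprt (a - b) \<le> b"
proof -
  show "pprt (a - b) \<le> pprt a" using assms by (intro pprt_mono) simp
  have "0 \<le> b + pprt (a - b)" using assms by (intro add_nonneg_nonneg) auto
  with le_add_pprt_diff have "pprt a \<le> b + pprt (a - b)"
    unfolding pprt_def[of a] by (rule le_supI)
  then show "pprt a - pprt (a - b) \<le> b" by (simp add: algebra_simps)
qed

text \<open>An abstract family of additive maps covers both uses: \<open>h |-> h (T |z|)\<close> on
  the dual of F, and \<open>z |-> |f| (T z)\<close> on E. The norm bound absorbs the vanishing
  correction \<open>(1/2)^n y\<close>.\<close>

lemma uniformly_small_modulo_interval:
  fixes A :: "'a::banach_lattice set" and \<phi> :: "'i \<Rightarrow> 'a \<Rightarrow> real"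
  assumes "bounded A"
    and add: "\<And>i x y. i \<in> I \<Longrightarrow> \<phi> i (x + y) = \<phi> i x + \<phi> i y"
    and bound: "\<And>i x. i \<in> I \<Longrightarrow> \<phi> i x \<le> C * norm x"
    and disj: "\<And>x e. disjoint_seq x \<Longrightarrow> range x \<subseteq> Sol A \<Longrightarrow> (\<And>n. 0 \<le> x n) \<Longrightarrow> 0 < e \<Longrightarrow>
      eventually (\<lambda>n. \<forall>i\<in>I. \<phi> i (x n) < e) sequentially"
    and "0 < \<epsilon>"
  shows "\<exists>u\<ge>0. \<forall>x\<in>A. \<forall>i\<in>I. \<phi> i (pprt (\<bar>x\<bar> - u)) < \<epsilon>"
proof (rule ccontr)
  assume "\<not> ?thesis"
  then have "\<forall>u. \<exists>x i. 0 \<le> u \<longrightarrow> x \<in> A \<and> i \<in> I \<and> \<epsilon> \<le> \<phi> i (pprt (\<bar>x\<bar> - u))"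
    by (meson not_le)
  then obtain X J where XJ:
    "\<And>u. 0 \<le> u \<Longrightarrow> X u \<in> A \<and> J u \<in> I \<and> \<epsilon> \<le> \<phi> (J u) (pprt (\<bar>X u\<bar> - u))"
    by metis
  \<comment> \<open>The choice at stage n depends on the sum of the earlier choices, so the partial
    sums are built by recursion. \<open>s n\<close> excludes \<open>x n\<close>, whence
    \<open>x n \<le> s m\<close> for n < m.\<close>
  define s where "s = rec_nat 0 (\<lambda>n t. t + \<bar>X (4^n *\<^sub>R t)\<bar>)"
  define x where "x n = \<bar>X (4^n *\<^sub>R s n)\<bar>" for n
  define j where "j n = J (4^n *\<^sub>R s n)" for n
  have s_simps: "s 0 = 0" "s (Suc n) = s n + x n" for n
    by (simp_all add: s_def x_def)
  have x_nonneg: "0 \<le> x n" for n by (simp add: x_def)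
  have s_eq: "s n = (\<Sum>k<n. x k)" for n by (induction n) (auto simp: s_simps)
  have s_nonneg: "0 \<le> s n" for n by (simp add: s_eq sum_nonneg x_nonneg)
  have s_ge: "x n \<le> s m" if "n < m" for n m
    unfolding s_eq using that x_nonneg by (intro le_sum) auto
  have scaled: "0 \<le> 4^n *\<^sub>R s n" for n using s_nonneg by (intro scaleR_nonneg_nonneg) auto
  have X_A: "X (4^n *\<^sub>R s n) \<in> A" and j_I: "j n \<in> I"
    and large: "\<epsilon> \<le> \<phi> (j n) (pprt (x n - 4^n *\<^sub>R s n))" for n
    using XJ[OF scaled[of n]] by (auto simp: x_def j_def)
  obtain B where B: "\<And>a. a \<in> A \<Longrightarrow> norm a \<le> B"
    using \<open>bounded A\<close> by (auto simp: bounded_iff)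
  have x_norm: "norm (x n) \<le> B" for n using B[OF X_A[of n]] by (simp add: x_def)
  \<comment> \<open>Boundedness of \<open>A\<close> makes the series absolutely convergent; its sum
    dominates each weighted term and becomes \<open>y\<close>.\<close>
  have "summable (\<lambda>n. (1/2)^n *\<^sub>R x n)"
  proof (rule summable_comparison_test')
    show "summable (\<lambda>n. (1/2)^n * B)" by (intro summable_mult2 summable_geometric) simp
    show "norm ((1/2)^n *\<^sub>R x n) \<le> (1/2)^n * B" if "n \<ge> 0" for n
      using x_norm[of n] by (simp add: mult_left_mono)
  qed
  then have "(1/2)^n *\<^sub>R x n \<le> (\<Sum>k. (1/2)^k *\<^sub>R x k)" for n
    by (rule le_suminf) (auto intro: scaleR_nonneg_nonneg x_nonneg)
  then obtain y where y: "\<And>n. (1/2)^n *\<^sub>R x n \<le> y" by blast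
  have y_nonneg: "0 \<le> y" using y[of 0] x_nonneg[of 0] by simp
  define w where "w n = pprt (x n - 4^n *\<^sub>R s n - (1/2)^n *\<^sub>R y)" for n
  have half_y: "0 \<le> (1/2)^n *\<^sub>R y" for n using y_nonneg by (intro scaleR_nonneg_nonneg) auto
  have "disjoint_seq w"
    unfolding w_def using s_ge s_nonneg y y_nonneg x_nonneg by (rule disjoint_seq_pprt)
  moreover have "range w \<subseteq> Sol A"
  proof safe
    fix n
    have "w n \<le> pprt (x n - 4^n *\<^sub>R s n)" unfolding w_def using half_y by (rule pprt_diff_le)
    also have "\<dots> \<le> pprt (x n)" using scaled by (rule pprt_diff_le)
    also have "\<dots> = x n" using x_nonneg by (simp add: pprt_eq_id)
    finally have "\<bar>w n\<bar> \<le> \<bar>X (4^n *\<^sub>R s n)\<bar>" by (simp add: x_def[symmetric] w_def)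
    then show "w n \<in> Sol A" using X_A unfolding Sol_def by auto
  qed
  moreover have "0 \<le> w n" for n by (simp add: w_def)
  ultimately have "eventually (\<lambda>n. \<forall>i\<in>I. \<phi> i (w n) < \<epsilon>/2) sequentially"
    using \<open>0 < \<epsilon>\<close> by (intro disj) simp_all
  \<comment> \<open>\<open>|C|\<close> appears because nothing fixes the sign of
    \<open>C\<close>.\<close>
  moreover have "(\<lambda>n. (1/2)^n * (\<bar>C\<bar> * norm y)) \<longlonglongrightarrow> 0"
    by (intro tendsto_mult_left_zero LIMSEQ_power_zero) simp
  then have "eventually (\<lambda>n. (1/2)^n * (\<bar>C\<bar> * norm y) < \<epsilon>/2) sequentially"
    using \<open>0 < \<epsilon>\<close> by (intro order_tendstoD) auto
  ultimately have "eventually (\<lambda>n. False) sequentially"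
  proof eventually_elim
    case (elim n)
    \<comment> \<open>\<open>v\<close> is the violating part and \<open>w n\<close> its disjoint
      correction. The map indexed by \<open>j n\<close> is below \<open>\<epsilon>/2\<close> on
      \<open>w n\<close>, and also on \<open>v - w n\<close>, which lies between 0 and a vanishing
      multiple of \<open>y\<close>. Additivity then contradicts \<open>large\<close>.\<close>
    define v where "v = pprt (x n - 4^n *\<^sub>R s n)"
    have v: "w n \<le> v" "v - w n \<le> (1/2)^n *\<^sub>R y"
      unfolding v_def w_def using half_y by (auto intro: pprt_diff_le)
    have "norm (v - w n) \<le> norm ((1/2)^n *\<^sub>R y)" using v by (intro norm_mono_nonneg) auto
    then have "\<bar>C\<bar> * norm (v - w n) \<le> \<bar>C\<bar> * norm ((1/2)^n *\<^sub>R y)" by (rule mult_left_mono) simp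
    then have "\<bar>C\<bar> * norm (v - w n) \<le> (1/2)^n * (\<bar>C\<bar> * norm y)" by (simp add: ac_simps)
    moreover have "C * norm (v - w n) \<le> \<bar>C\<bar> * norm (v - w n)"
      by (intro mult_right_mono) auto
    moreover have "\<phi> (j n) v = \<phi> (j n) (w n) + \<phi> (j n) (v - w n)"
      using add[OF j_I[of n], of "w n" "v - w n"] by simp
    moreover have "\<phi> (j n) (w n) < \<epsilon>/2" using elim j_I by auto
    moreover have "\<phi> (j n) (v - w n) \<le> C * norm (v - w n)" using j_I by (rule bound)
    moreover have "\<epsilon> \<le> \<phi> (j n) v" using large by (simp add: v_def)
    ultimately show False using elim by linarith
  qed
  then show False by simp
qed


section \<open>Functionals and positive operators\<close>

lemma blinfun_apply_mono_left:
  fixes f g :: "'a::banach_lattice \<Rightarrow>\<^sub>L real"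
  shows "f \<le> g \<Longrightarrow> 0 \<le> x \<Longrightarrow> blinfun_apply f x \<le> blinfun_apply g x"
  by (simp add: less_eq_blinfun_def)

lemma blinfun_apply_mono_right:
  fixes f :: "'a::banach_lattice \<Rightarrow>\<^sub>L real"
  assumes "0 \<le> f" "x \<le> y"
  shows "blinfun_apply f x \<le> blinfun_apply f y"
  using blinfun_apply_mono_left[OF assms(1), of "y - x"] assms(2)
  by (simp add: blinfun.diff_right)

text \<open>On positive vectors this is \<open>f \<le> |f|\<close> and \<open>- f \<le> |f|\<close>;
  the general case follows by splitting \<open>x\<close> into its positive and negative
  parts.\<close>

lemma abs_blinfun_apply_le:
  fixes f :: "'a::banach_lattice \<Rightarrow>\<^sub>L real"
  shows "\<bar>blinfun_apply f x\<bar> \<le> blinfun_apply \<bar>f\<bar> \<bar>x\<bar>"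
proof -
  have pos: "\<bar>blinfun_apply f y\<bar> \<le> blinfun_apply \<bar>f\<bar> y" if "0 \<le> y" for y
    using blinfun_apply_mono_left[OF abs_ge_self[of f] that]
      blinfun_apply_mono_left[OF abs_ge_minus_self[of f] that]
    by (simp add: blinfun.minus_left)
  have "\<bar>blinfun_apply f (pprt x - pprt (- x))\<bar> \<le> blinfun_apply \<bar>f\<bar> (pprt x + pprt (- x))"
    using pos[OF zero_le_pprt[of x]] pos[OF zero_le_pprt[of "- x"]]
    unfolding blinfun.diff_right blinfun.add_right by linarith
  moreover have "pprt x + pprt (- x) = \<bar>x\<bar>"
    using abs_prts[of x] by (simp add: pprt_neg)
  ultimately show ?thesis by (simp only: pprt_minus_pprt)
qed

lemma positive_operator_mono:
  assumes "positive_operator T" "x \<le> y"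
  shows "blinfun_apply T x \<le> blinfun_apply T y"
proof -
  have "0 \<le> blinfun_apply T (y - x)" using assms by (simp add: positive_operator_def)
  then show ?thesis by (simp add: blinfun.diff_right)
qed

lemma abs_positive_operator_le:
  assumes "positive_operator T"
  shows "\<bar>blinfun_apply T x\<bar> \<le> blinfun_apply T \<bar>x\<bar>"
proof (rule abs_leI)
  show "blinfun_apply T x \<le> blinfun_apply T \<bar>x\<bar>"
    using assms by (intro positive_operator_mono abs_ge_self)
  have "blinfun_apply T (- x) \<le> blinfun_apply T \<bar>x\<bar>"
    using assms by (intro positive_operator_mono abs_ge_minus_self)
  then show "- blinfun_apply T x \<le> blinfun_apply T \<bar>x\<bar>" by (simp add: blinfun.minus_right)
qed

lemma norm_blinfun_blinfun_le:
  fixes f :: "'b::real_normed_vector \<Rightarrow>\<^sub>L real" and T :: "'a::real_normed_vector \<Rightarrow>\<^sub>L 'b"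
  shows "f (T x) \<le> norm f * (norm T * norm x)"
proof -
  have "f (T x) \<le> norm (f (T x))" by simp
  also have "\<dots> \<le> norm f * norm (T x)" by (rule norm_blinfun)
  also have "\<dots> \<le> norm f * (norm T * norm x)" by (intro mult_left_mono norm_blinfun) simp
  finally show ?thesis .
qed

section \<open>Solid hulls and absolute values of disjoint sequences\<close>

lemma abs_in_Sol: "x \<in> Sol A \<Longrightarrow> \<bar>x\<bar> \<in> Sol A"
  by (auto simp: Sol_def)

lemma Sol_Sol: "Sol (Sol A) = Sol A"
  unfolding Sol_def by (auto intro: order_trans)

lemma bounded_Sol: "bounded A \<Longrightarrow> bounded (Sol A)"
  unfolding bounded_iff Sol_def by (blast intro: order_trans norm_abs_mono)

text \<open>Since \<open>Sol\<close> is idempotent, a set and its solid hull have the same disjoint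
  test sequences.\<close>

lemma disjointly_weakly_compact_Sol:
  "disjointly_weakly_compact A \<Longrightarrow> disjointly_weakly_compact (Sol A)"
  by (simp add: disjointly_weakly_compact_def bounded_Sol Sol_Sol)

lemma disjoint_seq_abs: "disjoint_seq x \<Longrightarrow> disjoint_seq (\<lambda>n. \<bar>x n\<bar>)"
  by (simp add: disjoint_seq_def)

text \<open>Absolute values do not preserve weak nullity in general; here \<open>|x n|\<close> is
  itself a disjoint sequence in \<open>Sol A\<close>.\<close>

lemma weakly_null_abs:
  assumes "disjointly_weakly_compact A" "disjoint_seq x" "range x \<subseteq> Sol A"
  shows "weakly_null (\<lambda>n. \<bar>x n\<bar>)"
proof -
  have "range (\<lambda>n. \<bar>x n\<bar>) \<subseteq> Sol A" using assms(3) abs_in_Sol by blast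
  then show ?thesis
    using assms disjoint_seq_abs by (auto simp: disjointly_weakly_compact_def)
qed

section \<open>Uniform smallness along disjoint sequences\<close>

lemma disjoint_functionals_uniformly_small:
  fixes T :: "'e::banach_lattice \<Rightarrow>\<^sub>L 'f::banach_lattice"
  assumes "DW_limited T" "disjointly_weakly_compact W" "disjointly_weakstar_compact V"
    and "disjoint_seq g" "range g \<subseteq> Sol V" "0 < e"
  shows "eventually (\<lambda>n. \<forall>x\<in>Sol W. \<bar>g n (T x)\<bar> < e) sequentially"
proof -
  \<comment> \<open>Passing to \<open>Sol W\<close> makes the estimate available at
    \<open>T |z|\<close> as well as at \<open>T z\<close>.\<close>
  have "limited_set (T ` Sol W)" "weakstar_null g"
    using assms disjointly_weakly_compact_Sol
    by (auto simp: DW_limited_def disjointly_weakstar_compact_def)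
  then have "(\<lambda>n. SUP y\<in>T ` Sol W. ennreal \<bar>g n y\<bar>) \<longlonglongrightarrow> 0"
    by (simp add: limited_set_def)
  then have "eventually (\<lambda>n. (SUP y\<in>T ` Sol W. ennreal \<bar>g n y\<bar>) < ennreal e) sequentially"
    using \<open>0 < e\<close> by (intro order_tendstoD) auto
  then show ?thesis
  proof eventually_elim
    case (elim n)
    show ?case
    proof
      fix x assume "x \<in> Sol W"
      then have "ennreal \<bar>g n (T x)\<bar> \<le> (SUP y\<in>T ` Sol W. ennreal \<bar>g n y\<bar>)"
        by (intro SUP_upper) auto
      also note elim
      finally show "\<bar>g n (T x)\<bar> < e" by (simp add: ennreal_less_iff)
    qed
  qed
qed

text \<open>Split \<open>|f| \<le> g + (|f| - g)^+\<close>: the second summand is uniformly small on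
  all \<open>T |z|\<close> with \<open>z\<close> in \<open>Sol W\<close>, and the first is a single
  functional evaluated along a weakly null sequence.\<close>

lemma disjoint_images_uniformly_small:
  fixes T :: "'e::banach_lattice \<Rightarrow>\<^sub>L 'f::banach_lattice"
  assumes T: "positive_operator T" "DW_limited T"
    and W: "disjointly_weakly_compact W" and V: "disjointly_weakstar_compact V"
    and x: "disjoint_seq x" "range x \<subseteq> Sol W" and "0 < e"
  shows "eventually (\<lambda>n. \<forall>f\<in>V. blinfun_apply \<bar>f\<bar> (T \<bar>x n\<bar>) < e) sequentially"
proof -
  obtain B where B: "\<And>z. z \<in> Sol W \<Longrightarrow> norm z \<le> B"
    using disjointly_weakly_compact_Sol[OF W]
    by (auto simp: disjointly_weakly_compact_def bounded_iff)
  have "\<exists>g\<ge>0. \<forall>f\<in>V. \<forall>z\<in>Sol W. blinfun_apply (pprt (\<bar>f\<bar> - g)) (T \<bar>z\<bar>) < e/2"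
  \<comment> \<open>The principle is applied in the dual of F: points \<open>z\<close> of
    \<open>Sol W\<close> index the maps, and \<open>V\<close> is the bounded set.\<close>
  proof (rule uniformly_small_modulo_interval[where \<phi> = "\<lambda>z h. blinfun_apply h (T \<bar>z\<bar>)"
        and C = "norm T * B"])
    show "bounded V" using V by (simp add: disjointly_weakstar_compact_def)
    fix z and h :: "'f \<Rightarrow>\<^sub>L real" assume "z \<in> Sol W"
    then have "norm h * (norm T * norm \<bar>z\<bar>) \<le> norm h * (norm T * B)"
      using B by (intro mult_left_mono) auto
    then show "h (T \<bar>z\<bar>) \<le> norm T * B * norm h"
      using norm_blinfun_blinfun_le[of h T "\<bar>z\<bar>"] by (simp add: ac_simps)
  next
    fix h :: "nat \<Rightarrow> 'f \<Rightarrow>\<^sub>L real" and e :: real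
    assume "disjoint_seq h" "range h \<subseteq> Sol V" "0 < e"
    then have "eventually (\<lambda>n. \<forall>z\<in>Sol W. \<bar>h n (T z)\<bar> < e) sequentially"
      by (rule disjoint_functionals_uniformly_small[OF T(2) W V])
    then show "eventually (\<lambda>n. \<forall>z\<in>Sol W. h n (T \<bar>z\<bar>) < e) sequentially"
      by eventually_elim (meson abs_in_Sol abs_less_iff)
  qed (use \<open>0 < e\<close> in \<open>auto simp: blinfun.add_left\<close>)
  then obtain g where
    g: "\<And>f z. f \<in> V \<Longrightarrow> z \<in> Sol W \<Longrightarrow> blinfun_apply (pprt (\<bar>f\<bar> - g)) (T \<bar>z\<bar>) < e/2"
    by blast
  have x_Sol: "x n \<in> Sol W" for n using x(2) by auto
  have "weakly_null (\<lambda>n. \<bar>x n\<bar>)" using W x by (rule weakly_null_abs)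
  then have "(\<lambda>n. (g o\<^sub>L T) \<bar>x n\<bar>) \<longlonglongrightarrow> 0" unfolding weakly_null_def by blast
  then have "eventually (\<lambda>n. (g o\<^sub>L T) \<bar>x n\<bar> < e/2) sequentially"
    using \<open>0 < e\<close> by (intro order_tendstoD) auto
  then show ?thesis
  proof eventually_elim
    case (elim n)
    show ?case
    proof
      fix f assume "f \<in> V"
      have "0 \<le> T \<bar>x n\<bar>" using T by (simp add: positive_operator_def)
      then have "blinfun_apply \<bar>f\<bar> (T \<bar>x n\<bar>) \<le> blinfun_apply (g + pprt (\<bar>f\<bar> - g)) (T \<bar>x n\<bar>)"
        by (intro blinfun_apply_mono_left le_add_pprt_diff)
      also have "\<dots> = g (T \<bar>x n\<bar>) + blinfun_apply (pprt (\<bar>f\<bar> - g)) (T \<bar>x n\<bar>)" by (rule blinfun.add_left)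
      also have "\<dots> < e" using g[OF \<open>f \<in> V\<close> x_Sol[of n]] elim by simp
      finally show "blinfun_apply \<bar>f\<bar> (T \<bar>x n\<bar>) < e" .
    qed
  qed
qed

theorem theorem3p3:
  fixes T :: "'e::banach_lattice \<Rightarrow>\<^sub>L 'f::banach_lattice"
    and W :: "'e set" and V :: "('f \<Rightarrow>\<^sub>L real) set"
  assumes "positive_operator T" and "DW_limited T"
    and "disjointly_weakly_compact W" and "disjointly_weakstar_compact V"
  shows "(\<forall>x. disjoint_seq x \<and> range x \<subseteq> Sol W \<longrightarrow>
            (\<lambda>n. SUP f\<in>Sol V. ennreal \<bar>blinfun_apply f (T (x n))\<bar>) \<longlonglongrightarrow> 0) \<and>
         (\<forall>\<epsilon>>0. \<exists>u\<ge>0. \<forall>x\<in>W. \<forall>f\<in>V. blinfun_apply \<bar>f\<bar> (T (pprt (\<bar>x\<bar> - u))) < \<epsilon>)"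
proof (intro conjI allI impI)
  fix x assume x: "disjoint_seq x \<and> range x \<subseteq> Sol W"
  show "(\<lambda>n. SUP f\<in>Sol V. ennreal \<bar>blinfun_apply f (T (x n))\<bar>) \<longlonglongrightarrow> 0"
  proof (rule order_tendstoI)
    fix a :: ennreal assume "0 < a"
    \<comment> \<open>Since \<open>a\<close> may be infinite, a smaller positive \<open>c\<close> is
      taken; \<open>c < a\<close> makes it finite, so it comes from a real \<open>e\<close>. The gap
      also restores strictness, as a supremum only inherits \<open>\<le> e\<close>.\<close>
    then obtain c where c: "0 < c" "c < a" using dense by blast
    moreover define e where "e = enn2real c"
    ultimately have e: "0 < e" "ennreal e < a"
      by (auto simp: enn2real_positive_iff less_le_trans[OF c(2) top_greatest])
    from x have "eventually (\<lambda>n. \<forall>f\<in>V. blinfun_apply \<bar>f\<bar> (T \<bar>x n\<bar>) < e) sequentially"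
      using e by (intro disjoint_images_uniformly_small[OF assms]) auto
    then show "eventually (\<lambda>n. (SUP f\<in>Sol V. ennreal \<bar>blinfun_apply f (T (x n))\<bar>) < a) sequentially"
    proof eventually_elim
      case (elim n)
      have "(SUP f\<in>Sol V. ennreal \<bar>blinfun_apply f (T (x n))\<bar>) \<le> ennreal e"
      proof (rule SUP_least)
        fix f assume "f \<in> Sol V"
        then obtain v where v: "v \<in> V" "\<bar>f\<bar> \<le> \<bar>v\<bar>" by (auto simp: Sol_def)
        \<comment> \<open>This chain passes from \<open>Sol V\<close> to \<open>V\<close>, and then,
          by positivity of \<open>T\<close>, from \<open>|T (x n)|\<close> to
          \<open>T |x n|\<close>.\<close>
        have "\<bar>f (T (x n))\<bar> \<le> blinfun_apply \<bar>f\<bar> \<bar>T (x n)\<bar>" by (rule abs_blinfun_apply_le)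
        also have "\<dots> \<le> blinfun_apply \<bar>v\<bar> \<bar>T (x n)\<bar>" using v by (intro blinfun_apply_mono_left) auto
        also have "\<dots> \<le> blinfun_apply \<bar>v\<bar> (T \<bar>x n\<bar>)"
          using assms(1) by (intro blinfun_apply_mono_right abs_positive_operator_le) auto
        also have "\<dots> \<le> e" using elim v by (simp add: less_imp_le)
        finally show "ennreal \<bar>f (T (x n))\<bar> \<le> ennreal e" by (rule ennreal_leI)
      qed
      also note e(2)
      finally show ?case .
    qed
  qed simp
next
  fix \<epsilon> :: real assume "0 < \<epsilon>"
  obtain B where B: "\<And>f. f \<in> V \<Longrightarrow> norm f \<le> B"
    using assms(4) by (auto simp: disjointly_weakstar_compact_def bounded_iff)
  show "\<exists>u\<ge>0. \<forall>x\<in>W. \<forall>f\<in>V. blinfun_apply \<bar>f\<bar> (T (pprt (\<bar>x\<bar> - u))) < \<epsilon>"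
  proof (rule uniformly_small_modulo_interval[where \<phi> = "\<lambda>f z. blinfun_apply \<bar>f\<bar> (T z)"
        and C = "B * norm T"])
    show "bounded W" using assms(3) by (simp add: disjointly_weakly_compact_def)
    fix f :: "'f \<Rightarrow>\<^sub>L real" and z :: 'e assume "f \<in> V"
    then have "norm \<bar>f\<bar> * (norm T * norm z) \<le> B * (norm T * norm z)"
      using B by (intro mult_right_mono) auto
    then show "blinfun_apply \<bar>f\<bar> (T z) \<le> B * norm T * norm z"
      using norm_blinfun_blinfun_le[of "\<bar>f\<bar>" T z] by (simp add: ac_simps)
  next
    fix x :: "nat \<Rightarrow> 'e" and e :: real
    assume "disjoint_seq x" "range x \<subseteq> Sol W" "0 < e" "\<And>n. 0 \<le> x n"
    then show "eventually (\<lambda>n. \<forall>f\<in>V. blinfun_apply \<bar>f\<bar> (T (x n)) < e) sequentially"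
      \<comment> \<open>The principle tests nonnegative sequences, for which \<open>|x n|\<close> is
        \<open>x n\<close>.\<close>
      using disjoint_images_uniformly_small[OF assms, of x e] by simp
  qed (use \<open>0 < \<epsilon>\<close> in \<open>auto simp: blinfun.add_right\<close>)
qed

end
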